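(* Let $G$ be a group and let $R$ be a $G$-graded ring. Then every proper graded ideal of $R$ is a graded weakly prime ideal of $R$ if and only if for any graded ideals $P$ and $Q$ of $R$ one has $PQ=P$, $PQ=Q$, or $PQ=0$.
   Context: Rings are associative, not necessarily commutative and not necessarily with unity; ideals are two-sided. A ring $R$ is $G$-graded if $R=\bigoplus_{g\in G}R_g$ with additive subgroups $R_g$ satisfying $R_gR_h\subseteq R_{gh}$ for all $g,h\in G$. An ideal $I$ of $R$ is graded if $I=\bigoplus_{g\in G}(I\cap R_g)$. The product $IJ$ of ideals is the additive subgroup of all finite sums of products $xy$ with $x\in I$, $y\in J$. A proper graded ideal $P$ of $R$ is a graded weakly prime ideal of $R$ if whenever $I,J$ are graded ideals of $R$ with $0\neq IJ\subseteq P$, then $I\subseteq P$ or $J\subseteq P$. *)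

theory Defs
  imports Main
begin

text \<open>
  Class \<open>ring\<close> demands neither commutativity nor a unit, and class \<open>group_add\<close> does not
  demand commutativity: despite the additive notation, it is the class of arbitrary groups.
  The group law of the grading group \<open>G\<close>, customarily a product \<open>gh\<close>, is written \<open>g + h\<close> below.
\<close>

definition add_subgroup :: "'r::ab_group_add set \<Rightarrow> bool" where
  "add_subgroup S \<longleftrightarrow> 0 \<in> S \<and> (\<forall>x\<in>S. \<forall>y\<in>S. x + y \<in> S) \<and> (\<forall>x\<in>S. - x \<in> S)"

definition fin_supp_families :: "('g \<Rightarrow> 'r::ab_group_add set) \<Rightarrow> ('g \<Rightarrow> 'r) set" where
  "fin_supp_families A = {f. finite {g. f g \<noteq> 0} \<and> (\<forall>g. f g \<in> A g)}"

text \<open>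
  \<open>S\<close> is the internal direct sum of the additive subgroups \<open>A g\<close>: the summation map from the
  external direct sum is a bijection onto \<open>S\<close>.
\<close>

definition is_direct_sum :: "'r::ab_group_add set \<Rightarrow> ('g \<Rightarrow> 'r set) \<Rightarrow> bool" where
  "is_direct_sum S A \<longleftrightarrow> (\<forall>g. add_subgroup (A g)) \<and>
     bij_betw (\<lambda>f. \<Sum>g | f g \<noteq> 0. f g) (fin_supp_families A) S"

definition grading :: "('g::group_add \<Rightarrow> 'r::ring set) \<Rightarrow> bool" where
  "grading R \<longleftrightarrow> is_direct_sum UNIV R \<and>
     (\<forall>g h. \<forall>x\<in>R g. \<forall>y\<in>R h. x * y \<in> R (g + h))"

definition two_sided_ideal :: "'r::ring set \<Rightarrow> bool" where
  "two_sided_ideal I \<longleftrightarrow> add_subgroup I \<and> (\<forall>x\<in>I. \<forall>r. r * x \<in> I \<and> x * r \<in> I)"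

definition graded_ideal :: "('g::group_add \<Rightarrow> 'r::ring set) \<Rightarrow> 'r set \<Rightarrow> bool" where
  "graded_ideal R I \<longleftrightarrow> two_sided_ideal I \<and> is_direct_sum I (\<lambda>g. I \<inter> R g)"

definition ideal_product :: "'r::ring set \<Rightarrow> 'r set \<Rightarrow> 'r set" where
  "ideal_product I J =
     {\<Sum>i<n. x i * y i | (n::nat) x y. \<forall>i<n. x i \<in> I \<and> y i \<in> J}"

definition graded_weakly_prime_ideal :: "('g::group_add \<Rightarrow> 'r::ring set) \<Rightarrow> 'r set \<Rightarrow> bool" where
  "graded_weakly_prime_ideal R P \<longleftrightarrow> graded_ideal R P \<and> P \<noteq> UNIV \<and>
     (\<forall>I J. graded_ideal R I \<longrightarrow> graded_ideal R J \<longrightarrow>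
        ideal_product I J \<noteq> {0} \<longrightarrow> ideal_product I J \<subseteq> P \<longrightarrow> I \<subseteq> P \<or> J \<subseteq> P)"

end

theory Submission
  imports Defs
begin

text \<open>
  The product \<open>PQ\<close> of two graded ideals is again a graded ideal, contained in \<open>P \<inter> Q\<close>. If every
  proper graded ideal is graded weakly prime, test this on \<open>PQ\<close> itself: either \<open>PQ\<close> is the whole
  ring, hence equal to \<open>P\<close>, or zero, or it contains \<open>P\<close> or \<open>Q\<close>. Conversely, if \<open>IJ\<close> is nonzero,
  then it equals \<open>I\<close> or \<open>J\<close>, so an ideal containing \<open>IJ\<close> contains \<open>I\<close> or \<open>J\<close>.
\<close>

lemma add_subgroupD:
  assumes "add_subgroup S"
  shows "0 \<in> S" "\<And>x y. x \<in> S \<Longrightarrow> y \<in> S \<Longrightarrow> x + y \<in> S" "\<And>x. x \<in> S \<Longrightarrow> - x \<in> S"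
  using assms by (auto simp: add_subgroup_def)

lemma add_subgroup_Int:
  assumes "add_subgroup S" "add_subgroup T"
  shows "add_subgroup (S \<inter> T)"
  using assms by (auto simp: add_subgroup_def)

lemma add_subgroup_sum:
  assumes "add_subgroup S" "\<And>i. i \<in> F \<Longrightarrow> f i \<in> S"
  shows "(\<Sum>i\<in>F. f i) \<in> S"
  using assms(2) by (induction F rule: infinite_finite_induct) (auto intro: add_subgroupD[OF assms(1)])

lemma two_sided_idealD:
  assumes "two_sided_ideal I"
  shows "add_subgroup I" "\<And>x r. x \<in> I \<Longrightarrow> r * x \<in> I" "\<And>x r. x \<in> I \<Longrightarrow> x * r \<in> I"
  using assms by (auto simp: two_sided_ideal_def)

lemma ideal_productI:
  assumes "\<And>i. i < n \<Longrightarrow> x i \<in> I" "\<And>i. i < n \<Longrightarrow> y i \<in> J"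
  shows "(\<Sum>i<n::nat. x i * y i) \<in> ideal_product I J"
  using assms unfolding ideal_product_def by blast

text \<open>The new product is appended at index \<open>n\<close>; updating \<open>x\<close> and
  \<open>y\<close> there leaves the first \<open>n\<close> terms untouched.\<close>

lemma ideal_product_add_mult:
  assumes "z \<in> ideal_product I J" "a \<in> I" "b \<in> J"
  shows "z + a * b \<in> ideal_product I J"
proof -
  obtain n :: nat and x y where z: "z = (\<Sum>i<n. x i * y i)" "\<forall>i<n. x i \<in> I \<and> y i \<in> J"
    using assms(1) by (auto simp: ideal_product_def)
  have "z + a * b = (\<Sum>i<Suc n. (x(n := a)) i * (y(n := b)) i)"
    using z(1) by simp
  moreover have "\<forall>i<Suc n. (x(n := a)) i \<in> I \<and> (y(n := b)) i \<in> J"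
    using z(2) assms by simp
  ultimately show ?thesis unfolding ideal_product_def by blast
qed

lemma zero_in_ideal_product: "0 \<in> ideal_product I J"
  unfolding ideal_product_def
  by (rule CollectI, rule exI[of _ 0]) simp

lemma mult_in_ideal_product:
  assumes "a \<in> I" "b \<in> J"
  shows "a * b \<in> ideal_product I J"
  using ideal_product_add_mult[OF zero_in_ideal_product assms] by simp

text \<open>Allowing any additive subgroup \<open>S\<close> serves two ends: \<open>S\<close> is an
  ideal when bounding the product, and a sum of homogeneous components when showing that it is
  graded.\<close>

lemma ideal_product_subset:
  assumes "add_subgroup S" "\<And>a b. a \<in> I \<Longrightarrow> b \<in> J \<Longrightarrow> a * b \<in> S"
  shows "ideal_product I J \<subseteq> S"
  unfolding ideal_product_def by (auto intro!: add_subgroup_sum[OF assms(1)] assms(2))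

lemma ideal_product_add:
  assumes "z \<in> ideal_product I J" "w \<in> ideal_product I J"
  shows "z + w \<in> ideal_product I J"
proof -
  obtain n :: nat and x y where w: "w = (\<Sum>i<n. x i * y i)" "\<forall>i<n. x i \<in> I \<and> y i \<in> J"
    using assms(2) by (auto simp: ideal_product_def)
  \<comment> \<open>The terms of \<open>w\<close> are appended to \<open>z\<close> one at a time, so
    no two index ranges have to be concatenated. The bound on \<open>m\<close> keeps each new index
    within reach of \<open>w(2)\<close>.\<close>
  have "m \<le> n \<Longrightarrow> z + (\<Sum>i<m. x i * y i) \<in> ideal_product I J" for m
  proof (induction m)
    case (Suc m)
    with ideal_product_add_mult[of "z + (\<Sum>i<m. x i * y i)" I J "x m" "y m"] w(2)
    show ?case by (simp add: add.assoc)
  qed (simp add: assms(1))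
  then show ?thesis using w(1) by simp
qed

lemma two_sided_ideal_product:
  assumes I: "two_sided_ideal I" and J: "two_sided_ideal J"
  shows "two_sided_ideal (ideal_product I J)"
proof -
  have "- z \<in> ideal_product I J \<and> r * z \<in> ideal_product I J \<and> z * r \<in> ideal_product I J"
    if z_in: "z \<in> ideal_product I J" for z r
  proof -
    obtain n :: nat and x y where z: "z = (\<Sum>i<n. x i * y i)" and xy: "\<forall>i<n. x i \<in> I \<and> y i \<in> J"
      using z_in by (auto simp: ideal_product_def)
    \<comment> \<open>A sign or a left multiplier is absorbed into the factors from
      \<open>I\<close>, a right multiplier into those from \<open>J\<close>.\<close>
    have "(\<Sum>i<n. (- x i) * y i) \<in> ideal_product I J"
      using xy by (intro ideal_productI) (auto intro: add_subgroupD(3) two_sided_idealD(1)[OF I])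
    moreover have "(\<Sum>i<n. (r * x i) * y i) \<in> ideal_product I J"
      using xy by (intro ideal_productI) (auto intro: two_sided_idealD(2)[OF I])
    moreover have "(\<Sum>i<n. x i * (y i * r)) \<in> ideal_product I J"
      using xy by (intro ideal_productI) (auto intro: two_sided_idealD(3)[OF J])
    ultimately show ?thesis
      by (simp add: z sum_negf sum_distrib_left sum_distrib_right mult.assoc)
  qed
  then show ?thesis
    unfolding two_sided_ideal_def add_subgroup_def
    by (blast intro: zero_in_ideal_product ideal_product_add)
qed

lemma ideal_product_le:
  assumes "two_sided_ideal I" "two_sided_ideal J"
  shows "ideal_product I J \<subseteq> I" "ideal_product I J \<subseteq> J"
  using two_sided_idealD[OF assms(1)] two_sided_idealD[OF assms(2)]
  by (intro ideal_product_subset; blast)+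

text \<open>The image of the summation map of \<open>is_direct_sum\<close>, named so that
  surjectivity can be treated apart from injectivity; the sum need not be direct.\<close>

definition sum_of_subgroups :: "('g \<Rightarrow> 'r::ab_group_add set) \<Rightarrow> 'r set" where
  "sum_of_subgroups A = (\<lambda>f. \<Sum>g | f g \<noteq> 0. f g) ` fin_supp_families A"

lemma sum_of_subgroupsE:
  assumes "z \<in> sum_of_subgroups A"
  obtains f where "z = (\<Sum>g | f g \<noteq> 0. f g)" "finite {g. f g \<noteq> 0}" "\<And>g. f g \<in> A g"
  using assms by (auto simp: sum_of_subgroups_def fin_supp_families_def)

text \<open>Any finite \<open>F\<close> containing the support will do, since the extra terms
  vanish. Exact supports, which may shrink by cancellation when families are added, need not be
  computed.\<close>

lemma sum_of_subgroupsI: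
  assumes "finite F" "\<And>g. g \<notin> F \<Longrightarrow> f g = 0" "\<And>g. f g \<in> A g"
  shows "(\<Sum>g\<in>F. f g) \<in> sum_of_subgroups A"
proof -
  have sub: "{g. f g \<noteq> 0} \<subseteq> F" using assms(2) by auto
  have "(\<Sum>g\<in>F. f g) = (\<Sum>g | f g \<noteq> 0. f g)"
    using assms(1) sub by (intro sum.mono_neutral_right) auto
  moreover have "f \<in> fin_supp_families A"
    using assms(3) finite_subset[OF sub assms(1)] by (simp add: fin_supp_families_def)
  ultimately show ?thesis unfolding sum_of_subgroups_def by blast
qed

lemma component_subset_sum:
  assumes "\<And>g. add_subgroup (A g)" "x \<in> A g"
  shows "x \<in> sum_of_subgroups A"
proof -
  have "(\<Sum>h\<in>{g}. if h = g then x else 0) \<in> sum_of_subgroups A"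
    using assms(2) add_subgroupD(1)[OF assms(1)] by (intro sum_of_subgroupsI) auto
  then show ?thesis by simp
qed

lemma add_subgroup_sum_of_subgroups:
  assumes A: "\<And>g. add_subgroup (A g)"
  shows "add_subgroup (sum_of_subgroups A)"
  unfolding add_subgroup_def
proof (intro conjI ballI)
  show "0 \<in> sum_of_subgroups A"
    using component_subset_sum[OF A add_subgroupD(1)[OF A]] .
next
  fix z w assume "z \<in> sum_of_subgroups A" "w \<in> sum_of_subgroups A"
  then obtain f f' where
    f: "z = (\<Sum>g | f g \<noteq> 0. f g)" "finite {g. f g \<noteq> 0}" "\<And>g. f g \<in> A g" and
    f': "w = (\<Sum>g | f' g \<noteq> 0. f' g)" "finite {g. f' g \<noteq> 0}" "\<And>g. f' g \<in> A g"
    by (elim sum_of_subgroupsE) metis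
  let ?F = "{g. f g \<noteq> 0} \<union> {g. f' g \<noteq> 0}"
  have "z = (\<Sum>g\<in>?F. f g)" "w = (\<Sum>g\<in>?F. f' g)"
    unfolding f(1) f'(1) using f(2) f'(2) by (auto intro!: sum.mono_neutral_left)
  then have "z + w = (\<Sum>g\<in>?F. f g + f' g)" by (simp add: sum.distrib)
  also have "\<dots> \<in> sum_of_subgroups A"
    using f f' by (intro sum_of_subgroupsI) (auto intro: add_subgroupD(2)[OF A])
  finally show "z + w \<in> sum_of_subgroups A" .
next
  fix z assume "z \<in> sum_of_subgroups A"
  then obtain f where
    f: "z = (\<Sum>g | f g \<noteq> 0. f g)" "finite {g. f g \<noteq> 0}" "\<And>g. f g \<in> A g"
    by (elim sum_of_subgroupsE) metis
  have "- z = (\<Sum>g | f g \<noteq> 0. - f g)" by (simp add: f(1) sum_negf)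
  also have "\<dots> \<in> sum_of_subgroups A"
    using f by (intro sum_of_subgroupsI) (auto intro: add_subgroupD(3)[OF A])
  finally show "- z \<in> sum_of_subgroups A" .
qed

text \<open>Families in \<open>S \<inter> R g\<close> are families in \<open>R g\<close>, so
  uniqueness of decompositions is inherited from the grading, and their sums stay in
  \<open>S\<close>. What remains is that each element of \<open>S\<close> has its homogeneous
  components in \<open>S\<close>.\<close>

lemma is_direct_sum_Int_iff:
  assumes R: "is_direct_sum UNIV R" and S: "add_subgroup S"
  shows "is_direct_sum S (\<lambda>g. S \<inter> R g) \<longleftrightarrow> S \<subseteq> sum_of_subgroups (\<lambda>g. S \<inter> R g)"
proof -
  have sub: "add_subgroup (S \<inter> R g)" for g
    using R S by (auto simp: is_direct_sum_def intro: add_subgroup_Int)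
  have "inj_on (\<lambda>f. \<Sum>g | f g \<noteq> 0. f g) (fin_supp_families R)"
    using R by (simp add: is_direct_sum_def bij_betw_def)
  then have inj: "inj_on (\<lambda>f. \<Sum>g | f g \<noteq> 0. f g) (fin_supp_families (\<lambda>g. S \<inter> R g))"
    by (rule inj_on_subset) (auto simp: fin_supp_families_def)
  have "sum_of_subgroups (\<lambda>g. S \<inter> R g) \<subseteq> S"
    by (auto elim!: sum_of_subgroupsE intro!: add_subgroup_sum[OF S])
  with sub inj show ?thesis
    by (auto simp: is_direct_sum_def bij_betw_def sum_of_subgroups_def)
qed

text \<open>Decompose \<open>a\<close> and \<open>b\<close> into components lying in
  \<open>I\<close> and \<open>J\<close>: each product of components is homogeneous and lies in the
  ideal product. Different pairs may share a degree \<open>g + h\<close>; closure of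
  \<open>sum_of_subgroups\<close> under addition avoids collecting them by degree.\<close>

lemma graded_ideal_product:
  assumes R: "grading R" and I: "graded_ideal R I" and J: "graded_ideal R J"
  shows "graded_ideal R (ideal_product I J)"
proof -
  let ?A = "\<lambda>g. ideal_product I J \<inter> R g"
  have RU: "is_direct_sum UNIV R" and Rmult: "\<And>g h x y. x \<in> R g \<Longrightarrow> y \<in> R h \<Longrightarrow> x * y \<in> R (g + h)"
    using R by (auto simp: grading_def)
  have idl: "two_sided_ideal I" "two_sided_ideal J"
    using I J by (auto simp: graded_ideal_def)
  note IJ = two_sided_ideal_product[OF idl]
  have sub: "add_subgroup (?A g)" for g
    using RU IJ by (auto simp: is_direct_sum_def intro: add_subgroup_Int two_sided_idealD(1))
  have "a * b \<in> sum_of_subgroups ?A" if ab: "a \<in> I" "b \<in> J" for a b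
  proof -
    have "a \<in> sum_of_subgroups (\<lambda>g. I \<inter> R g)" "b \<in> sum_of_subgroups (\<lambda>g. J \<inter> R g)"
      using I J ab is_direct_sum_Int_iff[OF RU] idl
      by (auto simp: graded_ideal_def dest: two_sided_idealD(1))
    then obtain f f' where
      f: "a = (\<Sum>g | f g \<noteq> 0. f g)" "\<And>g. f g \<in> I \<inter> R g" and
      f': "b = (\<Sum>g | f' g \<noteq> 0. f' g)" "\<And>g. f' g \<in> J \<inter> R g"
      by (elim sum_of_subgroupsE) metis
    have "a * b = (\<Sum>g | f g \<noteq> 0. \<Sum>h | f' h \<noteq> 0. f g * f' h)"
      by (simp add: f(1) f'(1) sum_product)
    moreover have "f g * f' h \<in> ?A (g + h)" for g h
      using f(2)[of g] f'(2)[of h] by (auto intro: mult_in_ideal_product Rmult)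
    then have "f g * f' h \<in> sum_of_subgroups ?A" for g h
      using component_subset_sum[of ?A, OF sub] by blast
    ultimately show ?thesis
      by (auto intro!: add_subgroup_sum add_subgroup_sum_of_subgroups sub)
  qed
  then have "ideal_product I J \<subseteq> sum_of_subgroups ?A"
    by (intro ideal_product_subset add_subgroup_sum_of_subgroups sub)
  then show ?thesis
    using is_direct_sum_Int_iff[OF RU two_sided_idealD(1)[OF IJ]] IJ by (simp add: graded_ideal_def)
qed

theorem proposition2p4:
  fixes R :: "'g::group_add \<Rightarrow> 'r::ring set"
  assumes "grading R"
  shows "(\<forall>P. graded_ideal R P \<and> P \<noteq> UNIV \<longrightarrow> graded_weakly_prime_ideal R P) \<longleftrightarrow>
    (\<forall>P Q. graded_ideal R P \<longrightarrow> graded_ideal R Q \<longrightarrow>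
       ideal_product P Q = P \<or> ideal_product P Q = Q \<or> ideal_product P Q = {0})"
proof (intro iffI allI impI)
  fix P Q
  assume wp: "\<forall>P. graded_ideal R P \<and> P \<noteq> UNIV \<longrightarrow> graded_weakly_prime_ideal R P"
    and P: "graded_ideal R P" and Q: "graded_ideal R Q"
  have le: "ideal_product P Q \<subseteq> P" "ideal_product P Q \<subseteq> Q"
    using P Q by (auto simp: graded_ideal_def dest: ideal_product_le)
  show "ideal_product P Q = P \<or> ideal_product P Q = Q \<or> ideal_product P Q = {0}"
  \<comment> \<open>\<open>wp\<close> covers proper ideals only, so the improper case is split off;
    there \<open>le\<close> forces both \<open>P\<close> and \<open>Q\<close> to be
    \<open>UNIV\<close>.\<close>
  proof (cases "ideal_product P Q = UNIV")
    case True
    with le show ?thesis by auto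
  next
    case False
    then have "graded_weakly_prime_ideal R (ideal_product P Q)"
      using wp graded_ideal_product[OF assms P Q] by blast
    \<comment> \<open>Primeness is applied to the factors \<open>P\<close> and \<open>Q\<close>
      themselves; \<open>le\<close> turns the resulting inclusion into an equality.\<close>
    with P Q le show ?thesis unfolding graded_weakly_prime_ideal_def by blast
  qed
next
  fix P
  assume prod: "\<forall>P Q. graded_ideal R P \<longrightarrow> graded_ideal R Q \<longrightarrow>
      ideal_product P Q = P \<or> ideal_product P Q = Q \<or> ideal_product P Q = {0}"
    and P: "graded_ideal R P \<and> P \<noteq> UNIV"
  have "I \<subseteq> P \<or> J \<subseteq> P"
    if "graded_ideal R I" "graded_ideal R J" "ideal_product I J \<noteq> {0}" "ideal_product I J \<subseteq> P" for I J
    using prod[rule_format, OF that(1,2)] that(3,4) by auto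
  with P show "graded_weakly_prime_ideal R P"
    unfolding graded_weakly_prime_ideal_def by blast
qed

end
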